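(* Let $\beta$ and $\gamma$ be compositions and let $r_\beta$ and $r_\gamma$ be the corresponding ribbon Schur functions. Then $r_\beta=r_\gamma$ if and only if $\mathcal{M}(\beta)=\mathcal{M}(\gamma)$ (equality of multisets).
   Context: A composition $\beta\vDash n$ is a finite list $\beta_1\cdots\beta_k$ of positive integers with sum $n$. $\lambda(\beta)$ denotes the partition obtained by sorting the components of $\beta$ in weakly decreasing order. $\alpha\ge\beta$ means $\alpha$ is a coarsening of $\beta$, i.e. obtained from $\beta$ by adding together adjacent components (possibly none). $\mathcal{M}(\beta)$ is the multiset $\{\lambda(\alpha)\mid\alpha\ge\beta\}$, with one entry for each coarsening $\alpha$ of $\beta$. A ribbon is a connected skew diagram $\lambda/\mu$ containing no $2\times2$ array of boxes. Ribbons of size $n$ correspond bijectively to compositions $\beta\vDash n$ by letting $\beta_i$ be the number of boxes in the $i$-th row from the bottom. The ribbon Schur function $r_\beta$ is the skew Schur function $s_{\lambda/\mu}$ of the ribbon $\lambda/\mu$ corresponding to $\beta$. *)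

theory Defs
  imports Main "HOL-Library.Multiset" "HOL-Library.FuncSet"
begin

definition composition :: "nat list \<Rightarrow> bool" where
  "composition \<beta> \<longleftrightarrow> (\<forall>b \<in> set \<beta>. 0 < b)"

definition coarsening :: "nat list \<Rightarrow> nat list \<Rightarrow> bool" where
  "coarsening \<alpha> \<beta> \<longleftrightarrow>
     (\<exists>bs. concat bs = \<beta> \<and> (\<forall>b \<in> set bs. b \<noteq> []) \<and> \<alpha> = map sum_list bs)"

definition sorted_partition :: "nat list \<Rightarrow> nat list" where
  "sorted_partition \<beta> = rev (sort \<beta>)"

text \<open>A composition has finitely many coarsenings (see \<open>finite_coarsenings\<close> below), so
  \<^const>\<open>mset_set\<close> contains each of them exactly once; different coarsenings with
  the same sorted form contribute separately to the image.\<close>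

definition coarsening_partitions :: "nat list \<Rightarrow> nat list multiset" where
  "coarsening_partitions \<beta> = image_mset sorted_partition (mset_set {\<alpha>. coarsening \<alpha> \<beta>})"

definition is_partition :: "nat list \<Rightarrow> bool" where
  "is_partition lam \<longleftrightarrow> sorted_wrt (\<ge>) lam \<and> (\<forall>p \<in> set lam. 0 < p)"

definition part :: "nat list \<Rightarrow> nat \<Rightarrow> nat" where
  "part lam i = (if i < length lam then lam ! i else 0)"

text \<open>Boxes are pairs (row, column), counted from 0, rows downwards from the top
  and columns rightwards (English notation).\<close>

definition skew_diagram :: "nat list \<Rightarrow> nat list \<Rightarrow> (nat \<times> nat) set" where
  "skew_diagram lam mu = {(i, j). part mu i \<le> j \<and> j < part lam i}"

definition skew_shape :: "nat list \<Rightarrow> nat list \<Rightarrow> bool" where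
  "skew_shape lam mu \<longleftrightarrow>
     is_partition lam \<and> is_partition mu \<and> (\<forall>i. part mu i \<le> part lam i)"

fun adjacent :: "nat \<times> nat \<Rightarrow> nat \<times> nat \<Rightarrow> bool" where
  "adjacent (i, j) (i', j') \<longleftrightarrow>
     (i = i' \<and> (j' = Suc j \<or> j = Suc j')) \<or> (j = j' \<and> (i' = Suc i \<or> i = Suc i'))"

definition connected_boxes :: "(nat \<times> nat) set \<Rightarrow> bool" where
  "connected_boxes D \<longleftrightarrow>
     (\<forall>c \<in> D. \<forall>d \<in> D. (c, d) \<in> {(x, y). x \<in> D \<and> y \<in> D \<and> adjacent x y}\<^sup>*)"

definition ribbon :: "nat list \<Rightarrow> nat list \<Rightarrow> bool" where
  "ribbon lam mu \<longleftrightarrow> skew_shape lam mu \<and> connected_boxes (skew_diagram lam mu) \<and>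
     (\<nexists>i j. {(i, j), (i, Suc j), (Suc i, j), (Suc i, Suc j)} \<subseteq> skew_diagram lam mu)"

definition row_lengths_from_bottom :: "(nat \<times> nat) set \<Rightarrow> nat list" where
  "row_lengths_from_bottom D =
     map (\<lambda>i. card {c \<in> D. fst c = i}) (rev (sorted_list_of_set (fst ` D)))"

definition semistandard :: "nat list \<Rightarrow> nat list \<Rightarrow> (nat \<times> nat \<Rightarrow> nat) \<Rightarrow> bool" where
  "semistandard lam mu T \<longleftrightarrow>
     T \<in> extensional (skew_diagram lam mu) \<and>
     (\<forall>i j j'. (i, j) \<in> skew_diagram lam mu \<longrightarrow> (i, j') \<in> skew_diagram lam mu \<longrightarrow>
        j < j' \<longrightarrow> T (i, j) \<le> T (i, j')) \<and>
     (\<forall>i i' j. (i, j) \<in> skew_diagram lam mu \<longrightarrow> (i', j) \<in> skew_diagram lam mu \<longrightarrow>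
        i < i' \<longrightarrow> T (i, j) < T (i', j))"

text \<open>A formal power series with integer coefficients in variables
  \<open>x\<^sub>0, x\<^sub>1, x\<^sub>2, \<dots>\<close> is given by its coefficients; the monomial \<open>x\<^sub>a x\<^sub>b \<cdots>\<close> is the
  finite multiset \<open>{#a, b, \<dots>#}\<close>. Tableau entries are variable indices, hence start at 0.\<close>

type_synonym power_series = "nat multiset \<Rightarrow> int"

definition content :: "nat list \<Rightarrow> nat list \<Rightarrow> (nat \<times> nat \<Rightarrow> nat) \<Rightarrow> nat multiset" where
  "content lam mu T = image_mset T (mset_set (skew_diagram lam mu))"

definition skew_schur :: "nat list \<Rightarrow> nat list \<Rightarrow> power_series" where
  "skew_schur lam mu = (\<lambda>m. int (card {T. semistandard lam mu T \<and> content lam mu T = m}))"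

text \<open>The ribbon of \<open>\<beta>\<close>: counting \<open>i\<close> from 0 at the bottom row, row \<open>i\<close> begins in the
  column in which row \<open>i - 1\<close> ends, namely column \<open>\<beta>\<^sub>0 + \<dots> + \<beta>\<^sub>i\<^sub>-\<^sub>1 - i\<close>; for a composition the
  subtraction does not truncate. \<open>ribbon_of_composition\<close> and \<open>row_lengths_ribbon\<close> below
  show that this is a ribbon with row lengths \<open>\<beta>\<close>, and \<open>skew_schur_ribbon\<close> that every
  such ribbon has the same skew Schur function.\<close>

definition ribbon_outer :: "nat list \<Rightarrow> nat list" where
  "ribbon_outer \<beta> = rev (map (\<lambda>i. sum_list (take (Suc i) \<beta>) - i) [0..<length \<beta>])"

definition ribbon_inner :: "nat list \<Rightarrow> nat list" where
  "ribbon_inner \<beta> =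
     filter (\<lambda>p. 0 < p) (rev (map (\<lambda>i. sum_list (take i \<beta>) - i) [0..<length \<beta>]))"

definition ribbon_schur :: "nat list \<Rightarrow> power_series" where
  "ribbon_schur \<beta> = skew_schur (ribbon_outer \<beta>) (ribbon_inner \<beta>)"


lemma finite_coarsenings:
  assumes "composition \<beta>"
  shows "finite {\<alpha>. coarsening \<alpha> \<beta>}"
proof -
  have "{\<alpha>. coarsening \<alpha> \<beta>} \<subseteq>
      {\<alpha>. set \<alpha> \<subseteq> {..sum_list \<beta>} \<and> length \<alpha> \<le> length \<beta>}"
  proof clarify
    fix \<alpha> assume "coarsening \<alpha> \<beta>"
    then obtain bs where bs: "concat bs = \<beta>" "\<forall>b \<in> set bs. b \<noteq> []" "\<alpha> = map sum_list bs"
      unfolding coarsening_def by blast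
    have "length bs \<le> length (concat bs)" using bs(2)
      by (induction bs) (auto simp: Suc_le_eq neq_Nil_conv)
    moreover have "sum_list \<alpha> = sum_list \<beta>"
      unfolding bs(1)[symmetric] bs(3) by (induction bs) auto
    ultimately show "set \<alpha> \<subseteq> {..sum_list \<beta>} \<and> length \<alpha> \<le> length \<beta>"
      using bs member_le_sum_list[of _ \<alpha>] by auto
  qed
  then show ?thesis
    by (rule finite_subset) (rule finite_lists_length_le, simp)
qed

lemma finite_skew_diagram: "finite (skew_diagram lam mu)"
proof (rule finite_subset)
  show "skew_diagram lam mu \<subseteq> Sigma {..<length lam} (\<lambda>i. {..<lam ! i})"
    by (auto simp: skew_diagram_def part_def split: if_splits)
qed simp

lemma finite_tableaux:
  "finite {T. semistandard lam mu T \<and> content lam mu T = m}"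
proof (rule finite_subset)
  show "{T. semistandard lam mu T \<and> content lam mu T = m} \<subseteq>
      (skew_diagram lam mu \<rightarrow>\<^sub>E set_mset m)"
    by (auto simp: semistandard_def content_def PiE_def finite_skew_diagram)
qed (simp add: finite_PiE finite_skew_diagram)

lemma part_filter_pos:
  assumes "sorted_wrt (\<ge>) xs"
  shows "part (filter (\<lambda>p. 0 < p) xs) i = part xs i"
  using assms
proof (induction xs arbitrary: i)
  case (Cons x xs)
  show ?case
  proof (cases "x = 0")
    case True
    then have z: "\<forall>y \<in> set xs. y = 0" using Cons.prems by auto
    then have "filter (\<lambda>p. 0 < p) xs = []" by (auto simp: filter_empty_conv)
    then show ?thesis using True z by (auto simp: part_def nth_Cons split: nat.splits)
  next
    case False
    then show ?thesis using Cons.IH[of "i - 1"] Cons.prems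
      by (cases i) (auto simp: part_def split: if_splits)
  qed
qed simp

lemma sum_take_ge:
  assumes "composition \<beta>" "i \<le> length \<beta>"
  shows "i \<le> sum_list (take i \<beta>)"
  using assms
proof (induction i)
  case (Suc i)
  then have "0 < \<beta> ! i" by (auto simp: composition_def)
  then show ?case using Suc by (simp add: take_Suc_conv_app_nth)
qed simp

context
  fixes \<beta> :: "nat list" and a :: "nat \<Rightarrow> nat"
  assumes comp: "composition \<beta>"
  defines "a \<equiv> \<lambda>i. sum_list (take i \<beta>) - i"
begin

private lemma a_Suc: "i < length \<beta> \<Longrightarrow> a (Suc i) + 1 = a i + \<beta> ! i"
proof -
  assume i: "i < length \<beta>"
  then have "0 < \<beta> ! i" using comp by (auto simp: composition_def)
  then show ?thesis
    using sum_take_ge[OF comp, of i] i by (simp add: a_def take_Suc_conv_app_nth)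
qed

private lemma outer_entry: "i < length \<beta> \<Longrightarrow> sum_list (take (Suc i) \<beta>) - i = Suc (a (Suc i))"
  using sum_take_ge[OF comp, of "Suc i"] by (simp add: a_def)

private lemma a_mono: "i \<le> j \<Longrightarrow> j \<le> length \<beta> \<Longrightarrow> a i \<le> a j"
proof (induction rule: dec_induct)
  case (step n)
  then have "0 < \<beta> ! n" using comp by (auto simp: composition_def)
  then show ?case using a_Suc[of n] step by simp
qed simp

private lemma outer_eq:
  "ribbon_outer \<beta> = rev (map (\<lambda>i. Suc (a (Suc i))) [0..<length \<beta>])"
  using outer_entry by (simp add: ribbon_outer_def)

private lemma inner_eq:
  "ribbon_inner \<beta> = filter (\<lambda>p. 0 < p) (rev (map a [0..<length \<beta>]))"
  by (simp add: ribbon_inner_def a_def)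

private lemma sorted_a: "sorted_wrt (\<ge>) (rev (map a [0..<length \<beta>]))"
  by (auto simp: sorted_wrt_iff_nth_less rev_nth intro!: a_mono)

private lemma part_outer:
  "part (ribbon_outer \<beta>) r = (if r < length \<beta> then Suc (a (length \<beta> - r)) else 0)"
  by (auto simp: outer_eq part_def rev_nth Suc_diff_Suc)

private lemma part_inner:
  "part (ribbon_inner \<beta>) r = (if r < length \<beta> then a (length \<beta> - Suc r) else 0)"
  unfolding inner_eq part_filter_pos[OF sorted_a] by (auto simp: part_def rev_nth)

private lemma diagram:
  "skew_diagram (ribbon_outer \<beta>) (ribbon_inner \<beta>) =
     {(r, j). r < length \<beta> \<and> a (length \<beta> - Suc r) \<le> j \<and> j \<le> a (length \<beta> - r)}"
  by (auto simp: skew_diagram_def part_outer part_inner split: if_splits)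

private lemma shape: "skew_shape (ribbon_outer \<beta>) (ribbon_inner \<beta>)"
proof -
  have "sorted_wrt (\<ge>) (ribbon_outer \<beta>)"
    by (auto simp: outer_eq sorted_wrt_iff_nth_less rev_nth intro!: a_mono)
  moreover have "sorted_wrt (\<ge>) (ribbon_inner \<beta>)"
    unfolding inner_eq by (rule sorted_wrt_filter[OF sorted_a])
  moreover have "\<forall>p \<in> set (ribbon_outer \<beta>). 0 < p" by (auto simp: outer_eq)
  moreover have "\<forall>p \<in> set (ribbon_inner \<beta>). 0 < p" by (auto simp: inner_eq)
  moreover have "part (ribbon_inner \<beta>) i \<le> part (ribbon_outer \<beta>) i" for i
    using a_mono[of "length \<beta> - Suc i" "length \<beta> - i"]
    by (simp add: part_inner part_outer diff_le_mono2 le_SucI)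
  ultimately show ?thesis by (simp add: skew_shape_def is_partition_def)
qed

private lemma connected: "connected_boxes (skew_diagram (ribbon_outer \<beta>) (ribbon_inner \<beta>))"
proof -
  define D where "D = skew_diagram (ribbon_outer \<beta>) (ribbon_inner \<beta>)"
  define R where "R = {(x, y). x \<in> D \<and> y \<in> D \<and> adjacent x y}"
  define k where "k = length \<beta>"
  have D: "(r, j) \<in> D \<longleftrightarrow> r < k \<and> a (k - Suc r) \<le> j \<and> j \<le> a (k - r)" for r j
    by (simp add: D_def diagram k_def)
  have symR: "sym R" by (auto simp: R_def sym_def)
  have row: "((r, a (k - Suc r)), (r, j)) \<in> R\<^sup>*"
    if "r < k" "a (k - Suc r) \<le> j" "j \<le> a (k - r)" for r j
    using that(2,3)
  proof (induction j rule: dec_induct)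
    case (step j)
    then have "((r, j), (r, Suc j)) \<in> R" using that(1) by (auto simp: R_def D)
    then show ?case using step by (meson Suc_leD rtrancl.rtrancl_into_rtrancl)
  qed simp
  have start: "((k - 1, a 0), (k - Suc i, a i)) \<in> R\<^sup>*" if "i < k" for i
    using that
  proof (induction i)
    case (Suc i)
    have le: "a i \<le> a (Suc i)" "a (Suc i) \<le> a (Suc (Suc i))"
      using Suc.prems by (auto intro!: a_mono simp: k_def)
    have e: "k - (k - Suc i) = Suc i" "k - Suc (k - Suc i) = i"
        "k - (k - Suc (Suc i)) = Suc (Suc i)" "k - Suc (k - Suc (Suc i)) = Suc i"
      using Suc.prems by auto
    have "((k - Suc i, a i), (k - Suc i, a (Suc i))) \<in> R\<^sup>*"
      using row[of "k - Suc i" "a (Suc i)"] Suc.prems le e by simp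
    moreover have "((k - Suc i, a (Suc i)), (k - Suc (Suc i), a (Suc i))) \<in> R"
      using Suc.prems le e by (auto simp: R_def D)
    ultimately show ?case using Suc by (meson Suc_lessD rtrancl.rtrancl_into_rtrancl rtrancl_trans)
  qed simp
  have base: "((k - 1, a 0), c) \<in> R\<^sup>*" if "c \<in> D" for c
  proof -
    obtain r j where c: "c = (r, j)" by (cases c)
    have r: "r < k" "a (k - Suc r) \<le> j" "j \<le> a (k - r)" using that c by (auto simp: D)
    have "k - Suc (k - Suc r) = r" using r by simp
    then show ?thesis using start[of "k - Suc r"] row[OF r] r(1) c by simp
  qed
  have "(c, d) \<in> R\<^sup>*" if "c \<in> D" "d \<in> D" for c d
    using base[OF that(1)] base[OF that(2)] sym_rtrancl[OF symR]
    by (meson rtrancl_trans symD)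
  then show ?thesis unfolding connected_boxes_def D_def R_def by blast
qed

lemma ribbon_of_composition: "ribbon (ribbon_outer \<beta>) (ribbon_inner \<beta>)"
proof -
  have "\<not> {(i, j), (i, Suc j), (Suc i, j), (Suc i, Suc j)} \<subseteq>
      skew_diagram (ribbon_outer \<beta>) (ribbon_inner \<beta>)" for i j
    by (auto simp: diagram)
  then show ?thesis using shape connected by (simp add: ribbon_def)
qed

lemma row_lengths_ribbon:
  "row_lengths_from_bottom (skew_diagram (ribbon_outer \<beta>) (ribbon_inner \<beta>)) = \<beta>"
proof -
  define D where "D = skew_diagram (ribbon_outer \<beta>) (ribbon_inner \<beta>)"
  have rows: "{c \<in> D. fst c = r} = Pair r ` {a (length \<beta> - Suc r)..a (length \<beta> - r)}"
    if "r < length \<beta>" for r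
    using that by (auto simp: D_def diagram)
  have len: "card {c \<in> D. fst c = length \<beta> - Suc i} = \<beta> ! i" if "i < length \<beta>" for i
  proof -
    have "length \<beta> - Suc (length \<beta> - Suc i) = i" "length \<beta> - (length \<beta> - Suc i) = Suc i"
      using that by auto
    then show ?thesis
      using that rows[of "length \<beta> - Suc i"] a_Suc[OF that] by (simp add: card_image inj_on_def)
  qed
  have "(r, a (length \<beta> - Suc r)) \<in> D" if "r < length \<beta>" for r
    using that a_mono[of "length \<beta> - Suc r" "length \<beta> - r"] by (auto simp: D_def diagram)
  then have "fst ` D = {0..<length \<beta>}"
    by (force simp: D_def diagram)
  then have "row_lengths_from_bottom D = map (\<lambda>i. card {c \<in> D. fst c = i}) (rev [0..<length \<beta>])"
    by (simp add: row_lengths_from_bottom_def)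
  also have "\<dots> = \<beta>"
    by (rule nth_equalityI) (simp_all add: rev_nth len)
  finally show ?thesis by (simp add: D_def)
qed

lemma ribbon_translate:
  assumes rib: "ribbon lam mu"
    and rows: "row_lengths_from_bottom (skew_diagram lam mu) = \<beta>"
  shows "\<exists>p c. skew_diagram lam mu =
    (\<lambda>(i, j). (i + p, j + c)) ` skew_diagram (ribbon_outer \<beta>) (ribbon_inner \<beta>)"
proof -
  define D where "D = skew_diagram lam mu"
  have D: "(i, j) \<in> D \<longleftrightarrow> part mu i \<le> j \<and> j < part lam i" for i j
    by (simp add: D_def skew_diagram_def)
  have fin: "finite (fst ` D)" by (simp add: D_def finite_skew_diagram)
  have card_row: "card {x \<in> D. fst x = i} = part lam i - part mu i" for i
  proof -
    have "{x \<in> D. fst x = i} = Pair i ` {part mu i..<part lam i}" by (auto simp: D)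
    then show ?thesis by (simp add: card_image inj_on_def)
  qed
  show ?thesis
  proof (cases "D = {}")
    case True
    then have "\<beta> = []" using rows by (simp add: row_lengths_from_bottom_def D_def)
    then have "skew_diagram (ribbon_outer \<beta>) (ribbon_inner \<beta>) = {}" unfolding diagram by simp
    then show ?thesis using True by (simp add: D_def)
  next
    case False
    define p where "p = Min (fst ` D)"
    define q where "q = Max (fst ` D)"
    have pD: "p \<in> fst ` D" and qD: "q \<in> fst ` D"
      unfolding p_def q_def using False Min_in[OF fin] Max_in[OF fin] by blast+
    have bounds: "p \<le> fst x" "fst x \<le> q" if "x \<in> D" for x
      using that fin by (auto simp: p_def q_def)
    have step: "\<exists>j. (r, j) \<in> D \<and> (Suc r, j) \<in> D" if r: "p \<le> r" "r < q" for r
    proof (rule ccontr)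
      assume neg: "\<not> ?thesis"
      obtain x y where xy: "x \<in> D" "y \<in> D" "fst x = p" "fst y = q" using pD qD by auto
      have "(x, y) \<in> {(x, y). x \<in> D \<and> y \<in> D \<and> adjacent x y}\<^sup>*"
        using rib xy by (auto simp: ribbon_def connected_boxes_def D_def)
      then have "fst y \<le> r"
      proof (induction rule: rtrancl_induct)
        case base
        then show ?case using xy r by simp
      next
        case (step y z)
        then show ?case using neg
          by (cases y; cases z) (auto simp: Suc_le_eq le_less)
      qed
      then show False using xy r by simp
    qed
    have next_row: "part lam (Suc r) = Suc (part mu r)" if r: "p \<le> r" "r < q" for r
    proof -
      obtain j where j: "(r, j) \<in> D" "(Suc r, j) \<in> D" using step[OF r] by blast
      have ss: "skew_shape lam mu" using rib by (simp add: ribbon_def)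
      have dec: "part ms (Suc r) \<le> part ms r" if "is_partition ms" for ms
        using that by (auto simp: is_partition_def part_def sorted_wrt_iff_nth_less)
      have m: "part mu (Suc r) \<le> part mu r" and l: "part lam (Suc r) \<le> part lam r"
        using ss dec by (auto simp: skew_shape_def)
      have "\<not> Suc (part mu r) < part lam (Suc r)"
      proof
        assume *: "Suc (part mu r) < part lam (Suc r)"
        then have "{(r, part mu r), (r, Suc (part mu r)), (Suc r, part mu r),
            (Suc r, Suc (part mu r))} \<subseteq> D" using m l by (auto simp: D)
        then show False using rib unfolding ribbon_def D_def by blast
      qed
      then show ?thesis using j by (auto simp: D)
    qed
    have pq: "p \<le> q" using pD bounds by auto
    have rowset: "fst ` D = {p..<Suc q}"
    proof
      show "fst ` D \<subseteq> {p..<Suc q}" using bounds by (auto simp: less_Suc_eq_le)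
      show "{p..<Suc q} \<subseteq> fst ` D"
      proof
        fix r assume "r \<in> {p..<Suc q}"
        then have "r = q \<or> p \<le> r \<and> r < q" by auto
        then show "r \<in> fst ` D" using step[of r] qD by force
      qed
    qed
    have beta: "\<beta> = map (\<lambda>i. part lam i - part mu i) (rev [p..<Suc q])"
      using rows rowset card_row by (simp add: row_lengths_from_bottom_def D_def)
    have len: "length \<beta> = Suc q - p" by (simp add: beta del: upt_Suc)
    have nthb: "\<beta> ! i = part lam (q - i) - part mu (q - i)" if "i < length \<beta>" for i
    proof -
      have "rev [p..<Suc q] ! i = q - i" using that len by (simp add: rev_nth del: upt_Suc)
      then show ?thesis using that len by (simp add: beta del: upt_Suc)
    qed
    have ne: "part mu r < part lam r" if "p \<le> r" "r \<le> q" for r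
    proof -
      have "r \<in> fst ` D" using that rowset by simp
      then show ?thesis by (auto simp: D)
    qed
    have lam_row: "part lam (q - i) = part mu (q - i) + \<beta> ! i" if "i < length \<beta>" for i
    proof -
      have "p \<le> q - i" using that len pq by linarith
      then show ?thesis using nthb[OF that] ne[of "q - i"] by simp
    qed
    have mu_row: "part mu (q - i) = part mu q + a i" if "i < length \<beta>" for i
      using that
    proof (induction i)
      case (Suc i)
      have "Suc (q - Suc i) = q - i" using Suc.prems len by simp
      moreover have "p \<le> q - Suc i" "q - Suc i < q" using Suc.prems len by auto
      ultimately have "part lam (q - i) = Suc (part mu (q - Suc i))"
        using next_row[of "q - Suc i"] by simp
      then show ?case using lam_row[of i] a_Suc[of i] Suc by simp
    qed (simp add: a_def)
    have shifted: "(i + p, j) \<in> D \<longleftrightarrow>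
        part mu q + a (length \<beta> - Suc i) \<le> j \<and> j \<le> part mu q + a (length \<beta> - i)"
      if "i < length \<beta>" for i j
    proof -
      let ?i = "length \<beta> - Suc i"
      have e: "q - ?i = i + p" "Suc ?i = length \<beta> - i" "?i < length \<beta>"
        using that len pq by auto
      then show ?thesis
        using mu_row[of ?i] lam_row[of ?i] a_Suc[of ?i] by (auto simp: D)
    qed
    have "D = (\<lambda>(i, j). (i + p, j + part mu q)) `
        {(r, j). r < length \<beta> \<and> a (length \<beta> - Suc r) \<le> j \<and> j \<le> a (length \<beta> - r)}"
      (is "D = ?f ` ?E")
    proof
      show "?f ` ?E \<subseteq> D" by (auto simp: shifted)
      show "D \<subseteq> ?f ` ?E"
      proof
        fix x assume x: "x \<in> D"
        obtain r j where rj: "x = (r, j)" by (cases x)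
        define i where "i = r - p"
        have i: "r = i + p" "i < length \<beta>" using bounds[OF x] rj len by (auto simp: i_def)
        then have "part mu q + a (length \<beta> - Suc i) \<le> j" "j \<le> part mu q + a (length \<beta> - i)"
          using shifted x rj by auto
        then have "(i, j - part mu q) \<in> ?E" "x = ?f (i, j - part mu q)"
          using i rj by auto
        then show "x \<in> ?f ` ?E" by blast
      qed
    qed
    then show ?thesis unfolding D_def diagram by blast
  qed
qed

end

lemma skew_schur_translate:
  assumes "skew_diagram lam' mu' = (\<lambda>(i, j). (i + p, j + c)) ` skew_diagram lam mu"
  shows "skew_schur lam' mu' = skew_schur lam mu"
proof
  fix m
  define f :: "nat \<times> nat \<Rightarrow> nat \<times> nat" where "f = (\<lambda>(i, j). (i + p, j + c))"
  define g :: "nat \<times> nat \<Rightarrow> nat \<times> nat" where "g = (\<lambda>(i, j). (i - p, j - c))"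
  define D where "D = skew_diagram lam mu"
  define E where "E = skew_diagram lam' mu'"
  have E: "E = f ` D" using assms by (simp add: D_def E_def f_def)
  have gf: "g (f x) = x" for x by (auto simp: f_def g_def split: prod.splits)
  have fp: "f (i, j) = (i + p, j + c)" for i j by (simp add: f_def)
  have inj: "inj_on f D" by (metis gf inj_onI)
  let ?A = "{T. semistandard lam' mu' T \<and> content lam' mu' T = m}"
  let ?B = "{T. semistandard lam mu T \<and> content lam mu T = m}"
  let ?F = "\<lambda>T. restrict (T \<circ> f) D"
  let ?G = "\<lambda>T. restrict (T \<circ> g) E"
  have mE: "mset_set E = image_mset f (mset_set D)"
    unfolding E by (rule image_mset_mset_set[OF inj, symmetric])
  have finD: "finite D" by (simp add: D_def finite_skew_diagram)
  have "bij_betw ?F ?A ?B"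
  proof (rule bij_betw_byWitness[where f' = ?G])
    show "\<forall>T \<in> ?A. ?G (?F T) = T"
    proof (clarify, rule ext)
      fix T x assume "semistandard lam' mu' T"
      then have "T \<in> extensional E" by (simp add: semistandard_def E_def)
      then have "x \<notin> E \<Longrightarrow> T x = undefined" by (rule extensional_arb)
      moreover have "g x \<in> D \<and> f (g x) = x" if "x \<in> E" using that by (auto simp: E gf)
      ultimately show "?G (?F T) x = T x" by (cases "x \<in> E") simp_all
    qed
    show "\<forall>T \<in> ?B. ?F (?G T) = T"
    proof (clarify, rule ext)
      fix T x assume "semistandard lam mu T"
      then have "T \<in> extensional D" by (simp add: semistandard_def D_def)
      then have "x \<notin> D \<Longrightarrow> T x = undefined" by (rule extensional_arb)
      moreover have "f x \<in> E" if "x \<in> D" using that by (simp add: E)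
      ultimately show "?F (?G T) x = T x" by (cases "x \<in> D") (simp_all add: gf)
    qed
    show "?F ` ?A \<subseteq> ?B"
    proof (clarify, intro conjI)
      fix T assume T: "semistandard lam' mu' T"
      have mem: "(i + p, j + c) \<in> E" if "(i, j) \<in> D" for i j
        using that fp[of i j] unfolding E by (metis image_eqI)
      show "semistandard lam mu (?F T)"
        using T mem unfolding semistandard_def D_def[symmetric] E_def[symmetric]
        by (auto simp: fp)
      show "content lam mu (?F T) = content lam' mu' T"
        unfolding content_def D_def[symmetric] E_def[symmetric] mE
        by (auto simp: finD image_mset.compositionality intro!: image_mset_cong)
    qed
    show "?G ` ?B \<subseteq> ?A"
    proof (clarify, intro conjI)
      fix T assume T: "semistandard lam mu T"
      have mem: "\<exists>i' j'. i = i' + p \<and> j = j' + c \<and> (i', j') \<in> D" if "(i, j) \<in> E" for i j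
        using that by (auto simp: E f_def)
      have gp: "g (i, j) = (i - p, j - c)" for i j by (simp add: g_def)
      show "semistandard lam' mu' (?G T)"
        unfolding semistandard_def E_def[symmetric]
      proof (intro conjI allI impI)
        fix i j j' assume "(i, j) \<in> E" "(i, j') \<in> E" "j < j'"
        then show "?G T (i, j) \<le> ?G T (i, j')"
          using mem[of i j] mem[of i j'] T
          by (auto simp: semistandard_def D_def[symmetric] gp)
      next
        fix i i' j assume "(i, j) \<in> E" "(i', j) \<in> E" "i < i'"
        then show "?G T (i, j) < ?G T (i', j)"
          using mem[of i j] mem[of i' j] T
          by (auto simp: semistandard_def D_def[symmetric] gp)
      qed simp
      show "content lam' mu' (?G T) = content lam mu T"
        unfolding content_def D_def[symmetric] E_def[symmetric] mE
        by (auto simp: finD E gf image_mset.compositionality intro!: image_mset_cong)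
    qed
  qed
  then show "skew_schur lam' mu' m = skew_schur lam mu m"
    by (simp add: skew_schur_def bij_betw_same_card)
qed

lemma skew_schur_ribbon:
  assumes "composition \<beta>" "ribbon lam mu"
    "row_lengths_from_bottom (skew_diagram lam mu) = \<beta>"
  shows "skew_schur lam mu = ribbon_schur \<beta>"
proof -
  obtain p c where "skew_diagram lam mu =
      (\<lambda>(i, j). (i + p, j + c)) ` skew_diagram (ribbon_outer \<beta>) (ribbon_inner \<beta>)"
    using ribbon_translate[OF assms] by (elim exE)
  then show ?thesis unfolding ribbon_schur_def by (rule skew_schur_translate)
qed

end

theory Submission
  imports
    "HOL-Library.Poly_Mapping"
    "HOL-Computational_Algebra.Fundamental_Theorem_Algebra"
    "HOL-Computational_Algebra.Polynomial_FPS"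
    Defs
begin

text \<open>
  Write \<open>h\<^sub>k\<close> for the complete homogeneous symmetric functions. A row of length \<open>a\<close> placed below
  a ribbon is either joined to its lowest row or becomes a new row, which gives \<open>h\<^sub>a r\<^bsub>b \<delta>\<^esub> = r\<^bsub>a b \<delta>\<^esub> + r\<^bsub>(a + b) \<delta>\<^esub>\<close>
  (\<open>complete_sum_mult_ribbon_sum\<close>). The coarsenings of \<open>a b \<delta>\<close> split in the same way, into those
  that keep the part \<open>a\<close> and those that merge it with \<open>b\<close>. Hence \<open>r\<^sub>\<beta>\<close> is the sum of
  \<open>(-1)\<^bsup>l(\<beta>) + l(\<alpha>)\<^esup> \<Prod> h\<^bsub>\<alpha>\<^sub>i\<^esub>\<close> over the coarsenings \<open>\<alpha>\<close> of \<open>\<beta>\<close>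
  (\<open>ribbon_sum_expansion\<close>), and each summand depends only on the partition obtained by sorting \<open>\<alpha>\<close>
  (\<open>ribbon_sum_coarsening_partitions\<close>).

  If the multisets of sorted coarsenings agree, so do the lengths of \<open>\<beta>\<close> and \<open>\<gamma>\<close>, since a composition
  is its own longest coarsening; then the two expansions are literally equal. Conversely the products
  \<open>\<Prod> h\<^bsub>\<lambda>\<^sub>i\<^esub>\<close> are linearly independent, so the multiplicities of every partition agree up
  to one global sign; as multiplicities are nonnegative and not all zero, the sign is \<open>+\<close>.

  To avoid a calculus of symmetric functions, everything is evaluated at finitely many elements of a
  commutative ring. Evaluated at formal variables, \<open>r\<^sub>\<beta>\<close> gives back its coefficients
  (\<open>lookup_ribbon_sum\<close>). Evaluated at complex numbers, it gives linear independence: by the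
  fundamental theorem of algebra, \<open>h\<^sub>1, \<dots>, h\<^sub>n\<close> can be given any prescribed values
  (\<open>complete_sums_arbitrary\<close>). With \<open>h\<^sub>k = z\<^bsup>B\<^sup>k\<^esup>\<close> for a large base \<open>B\<close>, different
  partitions give different powers of \<open>z\<close>, and it suffices to compare coefficients of polynomials in \<open>z\<close>.
\<close>

section \<open>Gluing rows of ribbons\<close>

definition sorted_words :: "nat \<Rightarrow> nat \<Rightarrow> nat list set" where
  "sorted_words N k = {w. length w = k \<and> sorted w \<and> set w \<subseteq> {..<N}}"

text \<open>
  The complete homogeneous symmetric polynomial \<open>h\<^sub>k(x\<^sub>0, \<dots>, x\<^bsub>N - 1\<^esub>)\<close>, as a sum over weakly
  increasing words. The ring is left open because two different ones are needed below: the complex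
  numbers, and a ring of formal polynomials.
\<close>

definition complete_sum :: "nat \<Rightarrow> (nat \<Rightarrow> 'a::comm_ring_1) \<Rightarrow> nat \<Rightarrow> 'a" where
  "complete_sum N x k = (\<Sum>w\<in>sorted_words N k. prod_list (map x w))"

text \<open>
  A tableau of ribbon shape, read row by row from the bottom. Consecutive rows share one column, which
  contains the last box of the lower row and the first box of the upper row.
\<close>

definition ribbon_fillings :: "nat list \<Rightarrow> nat list list set" where
  "ribbon_fillings \<beta> = {bs. map length bs = \<beta> \<and> (\<forall>b\<in>set bs. sorted b) \<and>
     successively (\<lambda>b c. hd c < last b) bs}"

definition bounded_fillings :: "nat \<Rightarrow> nat list \<Rightarrow> nat list list set" where
  "bounded_fillings N \<beta> = {bs \<in> ribbon_fillings \<beta>. set (concat bs) \<subseteq> {..<N}}"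

text \<open>
  The ribbon Schur function evaluated at \<open>x\<^sub>0, \<dots>, x\<^bsub>N - 1\<^esub>\<close>, all further variables being zero.
\<close>

definition ribbon_sum :: "nat \<Rightarrow> (nat \<Rightarrow> 'a::comm_ring_1) \<Rightarrow> nat list \<Rightarrow> 'a" where
  "ribbon_sum N x \<beta> = (\<Sum>bs\<in>bounded_fillings N \<beta>. prod_list (map x (concat bs)))"

lemma finite_sorted_words: "finite (sorted_words N k)"
  by (rule finite_subset[OF _ finite_lists_length_eq[of "{..<N}" k]]) (auto simp: sorted_words_def)

lemma finite_bounded_fillings: "finite (bounded_fillings N \<beta>)"
proof (rule finite_subset)
  show "bounded_fillings N \<beta> \<subseteq>
      {bs. set bs \<subseteq> {w. set w \<subseteq> {..<N} \<and> length w \<le> sum_list \<beta>} \<and> length bs = length \<beta>}"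
    by (auto simp: bounded_fillings_def ribbon_fillings_def member_le_sum_list)
  show "finite \<dots>"
    by (intro finite_lists_length_eq finite_lists_length_le) simp
qed

lemma ribbon_sum_Nil: "ribbon_sum N x [] = 1"
proof -
  have "bounded_fillings N [] = {[]}"
    by (auto simp: bounded_fillings_def ribbon_fillings_def)
  then show ?thesis by (simp add: ribbon_sum_def)
qed

lemma ribbon_sum_single: "ribbon_sum N x [a] = complete_sum N x a"
proof -
  have "bounded_fillings N [a] = (\<lambda>w. [w]) ` sorted_words N a"
    by (auto simp: bounded_fillings_def ribbon_fillings_def sorted_words_def)
  then show ?thesis
    by (simp add: ribbon_sum_def complete_sum_def sum.reindex inj_on_def)
qed

text \<open>
  Put a weakly increasing word of length \<open>a\<close> below a filling whose lowest row has length \<open>b\<close>. Either the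
  word ends with an entry larger than the first entry of that row, and then it becomes a new lowest row, or
  it does not, and then both can be joined to one weakly increasing row of length \<open>a + b\<close>.
\<close>

lemma complete_sum_mult_ribbon_sum:
  assumes "0 < a" "0 < b"
  shows "complete_sum N x a * ribbon_sum N x (b # \<beta>) =
    ribbon_sum N x (a # b # \<beta>) + ribbon_sum N x ((a + b) # \<beta>)"
proof -
  define P where "P = sorted_words N a \<times> bounded_fillings N (b # \<beta>)"
  define Q where "Q = {(w, bs) \<in> P. hd (hd bs) < last w}"
  define g where "g = (\<lambda>(w, bs). prod_list (map x w) * prod_list (map x (concat bs)))"
  have fin: "finite P" unfolding P_def using finite_sorted_words finite_bounded_fillings by blast
  have "complete_sum N x a * ribbon_sum N x (b # \<beta>) = sum g P"
    by (simp add: complete_sum_def ribbon_sum_def P_def g_def sum_product sum.cartesian_product)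
  also have "\<dots> = sum g (P - Q) + sum g Q"
    by (rule sum.subset_diff) (auto simp: Q_def fin)
  also have "sum g Q = ribbon_sum N x (a # b # \<beta>)"
    unfolding ribbon_sum_def
  proof (rule sum.reindex_bij_witness[where i = "\<lambda>bs. (hd bs, tl bs)" and j = "\<lambda>(w, bs). w # bs"];
      clarify?)
    fix w bs assume "(w, bs) \<in> Q"
    then show "w # bs \<in> bounded_fillings N (a # b # \<beta>)"
      by (cases bs) (auto simp: Q_def P_def bounded_fillings_def ribbon_fillings_def sorted_words_def)
  next
    fix bs assume "bs \<in> bounded_fillings N (a # b # \<beta>)"
    moreover from this obtain w c cs where "bs = w # c # cs"
      by (auto simp: bounded_fillings_def ribbon_fillings_def map_eq_Cons_conv)
    ultimately show "hd bs # tl bs = bs" "(hd bs, tl bs) \<in> Q"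
      by (auto simp: Q_def P_def bounded_fillings_def ribbon_fillings_def sorted_words_def)
  qed (auto simp: g_def)
  also have "sum g (P - Q) = ribbon_sum N x ((a + b) # \<beta>)"
    unfolding ribbon_sum_def
  proof (rule sum.reindex_bij_witness[where
        i = "\<lambda>bs. (take a (hd bs), drop a (hd bs) # tl bs)" and
        j = "\<lambda>(w, bs). (w @ hd bs) # tl bs"])
    fix p assume p: "p \<in> P - Q"
    obtain w bs where wbs: "p = (w, bs)" by (cases p)
    have "(w, bs) \<in> P" "(w, bs) \<notin> Q" using p wbs by auto
    then obtain c cs where c: "bs = c # cs" "length w = a" "length c = b" "sorted w" "sorted c"
        "set w \<subseteq> {..<N}" "bs \<in> bounded_fillings N (b # \<beta>)" "last w \<le> hd c"
      by (cases bs) (auto simp: Q_def P_def bounded_fillings_def ribbon_fillings_def sorted_words_def)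
    have ne: "w \<noteq> []" "c \<noteq> []" using c assms by auto
    have "u \<le> v" if "u \<in> set w" "v \<in> set c" for u v
    proof -
      have "u \<in> set (butlast w @ [last w])" "sorted (butlast w @ [last w])"
        using that(1) c(4) ne by simp_all
      then have "u \<le> last w" unfolding sorted_append by auto
      moreover have "hd c \<le> v" using that(2) c(5) by (cases c) auto
      ultimately show ?thesis using c(8) by linarith
    qed
    then show "(case p of (w, bs) \<Rightarrow> (w @ hd bs) # tl bs) \<in> bounded_fillings N ((a + b) # \<beta>)"
      using c ne unfolding wbs by (cases cs) (auto simp: bounded_fillings_def ribbon_fillings_def sorted_append)
    show "(take a (hd (case p of (w, bs) \<Rightarrow> (w @ hd bs) # tl bs)),
        drop a (hd (case p of (w, bs) \<Rightarrow> (w @ hd bs) # tl bs)) #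
          tl (case p of (w, bs) \<Rightarrow> (w @ hd bs) # tl bs)) = p"
      using c wbs by simp
    show "prod_list (map x (concat (case p of (w, bs) \<Rightarrow> (w @ hd bs) # tl bs))) = g p"
      using c wbs by (simp add: g_def mult.assoc)
  next
    fix bs assume bs: "bs \<in> bounded_fillings N ((a + b) # \<beta>)"
    then obtain c cs where c: "bs = c # cs" "length c = a + b" "sorted c" "set c \<subseteq> {..<N}"
      by (cases bs) (auto simp: bounded_fillings_def ribbon_fillings_def)
    have ne: "take a c \<noteq> []" "drop a c \<noteq> []" using c assms by auto
    have "last (take a c) \<le> hd (drop a c)"
      using c(3) ne by (metis append_take_drop_id hd_in_set last_in_set sorted_append)
    moreover have "last (drop a c) = last c" using ne by simp
    ultimately show "(take a (hd bs), drop a (hd bs) # tl bs) \<in> P - Q"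
      using bs c set_take_subset[of a c] set_drop_subset[of a c]
      by (cases cs) (auto simp: Q_def P_def bounded_fillings_def ribbon_fillings_def sorted_words_def
          sorted_wrt_take sorted_wrt_drop)
    show "(case (take a (hd bs), drop a (hd bs) # tl bs) of
        (w, bs) \<Rightarrow> (w @ hd bs) # tl bs) = bs"
      using c by simp
  qed
  finally show ?thesis by (simp only: add.commute)
qed

section \<open>Coarsenings\<close>

text \<open>
  The first part \<open>a\<close> either forms a block of its own or lies in one block with \<open>b\<close>.
\<close>

lemma coarsening_Cons_Cons:
  "coarsening \<alpha> (a # b # \<beta>) \<longleftrightarrow>
     (\<exists>\<alpha>'. \<alpha> = a # \<alpha>' \<and> coarsening \<alpha>' (b # \<beta>)) \<or> coarsening \<alpha> ((a + b) # \<beta>)" (is "?L \<longleftrightarrow> ?R")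
proof
  assume ?L
  then obtain bs where bs: "concat bs = a # b # \<beta>" "\<forall>b\<in>set bs. b \<noteq> []" "\<alpha> = map sum_list bs"
    by (auto simp: coarsening_def)
  then obtain cs ds where c: "bs = (a # cs) # ds" "cs @ concat ds = b # \<beta>"
    by (cases bs; cases "hd bs") auto
  show ?R
  proof (cases cs)
    case Nil
    then have "coarsening (map sum_list ds) (b # \<beta>)"
      unfolding coarsening_def using bs c by (intro exI[of _ ds]) auto
    then show ?thesis using bs c Nil by auto
  next
    case (Cons d es)
    then have "coarsening \<alpha> ((a + b) # \<beta>)"
      unfolding coarsening_def using bs c by (intro exI[of _ "((a + b) # es) # ds"]) auto
    then show ?thesis ..
  qed
next
  assume ?R
  then show ?L
  proof
    assume "\<exists>\<alpha>'. \<alpha> = a # \<alpha>' \<and> coarsening \<alpha>' (b # \<beta>)"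
    then obtain bs where bs: "concat bs = b # \<beta>" "\<forall>b\<in>set bs. b \<noteq> []" "\<alpha> = a # map sum_list bs"
      by (auto simp: coarsening_def)
    then show ?thesis unfolding coarsening_def by (intro exI[of _ "[a] # bs"]) auto
  next
    assume "coarsening \<alpha> ((a + b) # \<beta>)"
    then obtain bs where bs: "concat bs = (a + b) # \<beta>" "\<forall>b\<in>set bs. b \<noteq> []" "\<alpha> = map sum_list bs"
      by (auto simp: coarsening_def)
    then obtain cs ds where c: "bs = ((a + b) # cs) # ds" "cs @ concat ds = \<beta>"
      by (cases bs; cases "hd bs") auto
    then show ?thesis
      unfolding coarsening_def using bs by (intro exI[of _ "(a # b # cs) # ds"]) auto
  qed
qed

lemma coarsening_Nil: "coarsening \<alpha> [] \<longleftrightarrow> \<alpha> = []"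
  unfolding coarsening_def by (auto simp: concat_eq_Nil_conv)

lemma coarsening_single: "coarsening \<alpha> [a] \<longleftrightarrow> \<alpha> = [a]"
proof
  assume "coarsening \<alpha> [a]"
  then obtain bs where bs: "concat bs = [a]" "\<forall>b\<in>set bs. b \<noteq> []" "\<alpha> = map sum_list bs"
    by (auto simp: coarsening_def)
  then show "\<alpha> = [a]" by (cases bs; cases "hd bs"; cases "tl bs") auto
qed (auto simp: coarsening_def intro!: exI[of _ "[[a]]"])

lemma coarsening_refl: "coarsening \<beta> \<beta>"
  unfolding coarsening_def by (intro exI[of _ "map (\<lambda>b. [b]) \<beta>"]) (auto simp: o_def)

lemma coarsening_composition: "coarsening \<alpha> \<beta> \<Longrightarrow> composition \<beta> \<Longrightarrow> composition \<alpha>"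
  unfolding coarsening_def composition_def
  by (force simp: neq_Nil_conv)

lemma coarsening_sum_list: "coarsening \<alpha> \<beta> \<Longrightarrow> sum_list \<alpha> = sum_list \<beta>"
proof -
  have "sum_list (map sum_list bs) = sum_list (concat bs)" for bs :: "nat list list"
    by (induction bs) auto
  then show "coarsening \<alpha> \<beta> \<Longrightarrow> ?thesis" by (auto simp: coarsening_def)
qed

lemma coarsening_length: "coarsening \<alpha> \<beta> \<Longrightarrow> length \<alpha> \<le> length \<beta>"
proof (induction "length \<beta>" arbitrary: \<alpha> \<beta>)
  case (Suc n)
  then consider b where "\<beta> = [b]" | a b \<beta>' where "\<beta> = a # b # \<beta>'"
    by (metis length_Suc_conv list.exhaust)
  then show ?case
  proof cases
    case 1
    then show ?thesis using Suc.prems by (simp add: coarsening_single)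
  next
    case (2 a b \<beta>')
    then show ?thesis
      using Suc.prems Suc.hyps(1)[of "b # \<beta>'"] Suc.hyps(1)[of "(a + b) # \<beta>'"] Suc.hyps(2)
      by (fastforce simp: coarsening_Cons_Cons)
  qed
qed (simp add: coarsening_Nil)

text \<open>
  Both sides satisfy the recursion \<open>f (a b \<delta>) = h\<^sub>a f (b \<delta>) - f ((a + b) \<delta>)\<close>: the left side by gluing
  rows, the right side because coarsenings that keep the part \<open>a\<close> and coarsenings that merge it are told
  apart by their first part.
\<close>

lemma ribbon_sum_expansion:
  assumes "composition \<beta>"
  shows "ribbon_sum N x \<beta> =
    (\<Sum>\<alpha> | coarsening \<alpha> \<beta>. (-1) ^ (length \<beta> + length \<alpha>) * prod_list (map (complete_sum N x) \<alpha>))"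
  using assms
proof (induction "length \<beta>" arbitrary: \<beta>)
  case 0
  then show ?case by (simp add: ribbon_sum_Nil coarsening_Nil)
next
  case (Suc n)
  consider b where "\<beta> = [b]" | a b \<beta>' where "\<beta> = a # b # \<beta>'"
    using Suc(2) by (metis length_Suc_conv list.exhaust)
  then show ?case
  proof cases
    case 1
    then show ?thesis by (simp add: ribbon_sum_single coarsening_single)
  next
    case (2 a b \<beta>')
    define A where "A = {\<alpha>. coarsening \<alpha> (b # \<beta>')}"
    define B where "B = {\<alpha>. coarsening \<alpha> ((a + b) # \<beta>')}"
    define t where "t = (\<lambda>\<alpha>. (-1) ^ (length \<beta> + length \<alpha>) * prod_list (map (complete_sum N x) \<alpha>))"
    have comp: "composition (b # \<beta>')" "composition ((a + b) # \<beta>')" and pos: "0 < a" "0 < b"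
      using Suc.prems 2 by (auto simp: composition_def)
    have fin: "finite A" "finite B" using comp finite_coarsenings by (auto simp: A_def B_def)
    \<comment> \<open>Coarsenings that merge the first two parts start with a part larger than \<open>a\<close>.\<close>
    have "a + b \<le> hd \<alpha>" if al: "\<alpha> \<in> B" for \<alpha>
    proof -
      obtain bs where bs: "concat bs = (a + b) # \<beta>'" "\<forall>b\<in>set bs. b \<noteq> []" "\<alpha> = map sum_list bs"
        using al unfolding B_def coarsening_def by blast
      then show ?thesis by (cases bs; cases "hd bs") auto
    qed
    then have disj: "(#) a ` A \<inter> B = {}" using pos by force
    have "{\<alpha>. coarsening \<alpha> \<beta>} = (#) a ` A \<union> B"
      by (auto simp: 2 A_def B_def coarsening_Cons_Cons)
    then have "(\<Sum>\<alpha> | coarsening \<alpha> \<beta>. t \<alpha>) = (\<Sum>\<alpha>\<in>A. t (a # \<alpha>)) + sum t B"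
      using fin disj by (simp add: sum.union_disjoint sum.reindex inj_on_def)
    also have "(\<Sum>\<alpha>\<in>A. t (a # \<alpha>)) = complete_sum N x a * ribbon_sum N x (b # \<beta>')"
      using Suc(1)[OF _ comp(1)] Suc(2)
      by (simp add: 2 A_def t_def sum_distrib_left algebra_simps)
    also have "sum t B = - ribbon_sum N x ((a + b) # \<beta>')"
      using Suc(1)[OF _ comp(2)] Suc(2)
      by (simp add: 2 B_def t_def sum_negf)
    also have "complete_sum N x a * ribbon_sum N x (b # \<beta>') + - ribbon_sum N x ((a + b) # \<beta>') =
        ribbon_sum N x \<beta>"
      using complete_sum_mult_ribbon_sum[OF pos, of N x \<beta>'] by (simp add: 2)
    finally show ?thesis by (simp add: t_def)
  qed
qed

section \<open>Ribbon tableaux as fillings\<close>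

text \<open>
  The column in which row \<open>i\<close>, counted from the bottom, begins. For \<open>i > 0\<close> it is also the column in
  which row \<open>i - 1\<close> ends, because consecutive rows of a ribbon overlap in one column; the value at
  \<open>length \<beta>\<close> is the column in which the top row ends.
\<close>

definition row_start :: "nat list \<Rightarrow> nat \<Rightarrow> nat" where
  "row_start \<beta> i = sum_list (take i \<beta>) - i"

text \<open>
  The boxes listed in reading order, so that applying a tableau entrywise yields its filling. The
  diagram counts rows from the top, the composition from the bottom, whence \<open>length \<beta> - Suc i\<close>.
\<close>

definition ribbon_cells :: "nat list \<Rightarrow> (nat \<times> nat) list list" where
  "ribbon_cells \<beta> = map (\<lambda>i. map (\<lambda>t. (length \<beta> - Suc i, row_start \<beta> i + t)) [0..<\<beta> ! i])
     [0..<length \<beta>]"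

lemma length_ribbon_cells: "map length (ribbon_cells \<beta>) = \<beta>"
  by (auto simp: ribbon_cells_def intro: nth_equalityI)

lemma row_start_Suc:
  assumes "composition \<beta>" "i < length \<beta>"
  shows "Suc (row_start \<beta> (Suc i)) = row_start \<beta> i + \<beta> ! i"
proof -
  have "0 < \<beta> ! i" using assms by (auto simp: composition_def)
  then show ?thesis
    using sum_take_ge[OF assms(1), of i] assms(2) by (simp add: row_start_def take_Suc_conv_app_nth)
qed

lemma row_start_mono:
  assumes "composition \<beta>" "i \<le> j" "j \<le> length \<beta>"
  shows "row_start \<beta> i \<le> row_start \<beta> j"
  using assms(2,3)
proof (induction rule: dec_induct)
  case (step n)
  then have "0 < \<beta> ! n" using assms(1) by (auto simp: composition_def)
  then show ?case using row_start_Suc[OF assms(1), of n] step by simp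
qed simp

lemma ribbon_diagram_row:
  assumes "composition \<beta>" "i < length \<beta>"
  shows "(length \<beta> - Suc i, j) \<in> skew_diagram (ribbon_outer \<beta>) (ribbon_inner \<beta>) \<longleftrightarrow>
    row_start \<beta> i \<le> j \<and> j \<le> row_start \<beta> (Suc i)"
proof -
  let ?inner = "rev (map (row_start \<beta>) [0..<length \<beta>])"
  have "sorted_wrt (\<ge>) ?inner"
    using row_start_mono[OF assms(1)] by (auto simp: sorted_wrt_iff_nth_less rev_nth)
  then have "part (ribbon_inner \<beta>) = part ?inner"
    using part_filter_pos[of ?inner] by (simp add: ribbon_inner_def row_start_def[abs_def] fun_eq_iff)
  then have "part (ribbon_inner \<beta>) (length \<beta> - Suc i) = row_start \<beta> i"
    using assms(2) by (simp add: part_def rev_nth)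
  moreover have "part (ribbon_outer \<beta>) (length \<beta> - Suc i) = Suc (row_start \<beta> (Suc i))"
  proof -
    have "length \<beta> - Suc i < length \<beta>" "length \<beta> - Suc (length \<beta> - Suc i) = i"
      using assms(2) by simp_all
    moreover have "sum_list (take (Suc i) \<beta>) - i = Suc (sum_list (take (Suc i) \<beta>) - Suc i)"
      using sum_take_ge[OF assms(1), of "Suc i"] assms(2) by linarith
    ultimately show ?thesis using assms(2)
      by (simp add: part_def ribbon_outer_def rev_nth row_start_def)
  qed
  ultimately show ?thesis by (auto simp: skew_diagram_def)
qed

lemma set_ribbon_cells:
  assumes "composition \<beta>"
  shows "set (concat (ribbon_cells \<beta>)) = skew_diagram (ribbon_outer \<beta>) (ribbon_inner \<beta>)"
    (is "?L = ?D")
proof -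
  have cells: "(r, j) \<in> ?L \<longleftrightarrow> (\<exists>i<length \<beta>. r = length \<beta> - Suc i \<and>
      row_start \<beta> i \<le> j \<and> j \<le> row_start \<beta> (Suc i))" for r j
  proof -
    have "(\<exists>t<\<beta> ! i. j = row_start \<beta> i + t) \<longleftrightarrow> row_start \<beta> i \<le> j \<and> j \<le> row_start \<beta> (Suc i)"
      if "i < length \<beta>" for i
    proof -
      have "row_start \<beta> i \<le> j \<and> j \<le> row_start \<beta> (Suc i) \<longleftrightarrow> row_start \<beta> i \<le> j \<and> j < row_start \<beta> i + \<beta> ! i"
        using row_start_Suc[OF assms that] by linarith
      then show ?thesis by (metis le_Suc_ex less_add_eq_less nat_add_left_cancel_less le_add1)
    qed
    then show ?thesis by (fastforce simp: ribbon_cells_def)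
  qed
  have rows: "r < length \<beta>" if "(r, j) \<in> ?D" for r j
    using that by (auto simp: skew_diagram_def part_def ribbon_outer_def split: if_splits)
  have "(r, j) \<in> ?L \<longleftrightarrow> (r, j) \<in> ?D" for r j
  proof
    assume "(r, j) \<in> ?L"
    then show "(r, j) \<in> ?D" using cells ribbon_diagram_row[OF assms] by auto
  next
    assume D: "(r, j) \<in> ?D"
    then have "length \<beta> - Suc r < length \<beta>" "r = length \<beta> - Suc (length \<beta> - Suc r)"
      using rows by fastforce+
    then show "(r, j) \<in> ?L" using cells ribbon_diagram_row[OF assms] D by metis
  qed
  then show ?thesis by auto
qed

lemma distinct_ribbon_cells:
  assumes "composition \<beta>"
  shows "distinct (concat (ribbon_cells \<beta>))"
proof (rule distinct_concat)
  show "distinct (ribbon_cells \<beta>)"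
    unfolding ribbon_cells_def distinct_map
  proof (intro conjI inj_onI)
    fix i i' assume i: "i \<in> set [0..<length \<beta>]" "i' \<in> set [0..<length \<beta>]"
      and eq: "map (\<lambda>t. (length \<beta> - Suc i, row_start \<beta> i + t)) [0..<\<beta> ! i] =
        map (\<lambda>t. (length \<beta> - Suc i', row_start \<beta> i' + t)) [0..<\<beta> ! i']"
    have "0 < \<beta> ! i" "0 < \<beta> ! i'" using i assms by (auto simp: composition_def)
    then have "length \<beta> - Suc i = length \<beta> - Suc i'"
      using arg_cong[OF eq, of hd] by (simp add: hd_map)
    then show "i = i'" using i by auto
  qed simp
next
  fix xs assume "xs \<in> set (ribbon_cells \<beta>)"
  then show "distinct xs" by (auto simp: ribbon_cells_def distinct_map inj_on_def)
next
  fix xs ys assume xy: "xs \<in> set (ribbon_cells \<beta>)" "ys \<in> set (ribbon_cells \<beta>)" "xs \<noteq> ys"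
  obtain i where i: "i < length \<beta>" "xs = map (\<lambda>t. (length \<beta> - Suc i, row_start \<beta> i + t)) [0..<\<beta> ! i]"
    using xy(1) by (auto simp: ribbon_cells_def)
  obtain i' where i': "i' < length \<beta>" "ys = map (\<lambda>t. (length \<beta> - Suc i', row_start \<beta> i' + t)) [0..<\<beta> ! i']"
    using xy(2) by (auto simp: ribbon_cells_def)
  have "i \<noteq> i'" using xy(3) i(2) i'(2) by metis
  then have "length \<beta> - Suc i \<noteq> length \<beta> - Suc i'" using i(1) i'(1) by linarith
  then show "set xs \<inter> set ys = {}" unfolding i(2) i'(2) by auto
qed

lemma ex_extensional_map:
  assumes "distinct xs" "length xs = length ys"
  shows "\<exists>f\<in>extensional (set xs). map f xs = ys"
proof
  let ?f = "restrict (the \<circ> map_of (zip xs ys)) (set xs)"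
  show "map ?f xs = ys"
    using assms by (intro nth_equalityI) (simp_all add: map_of_zip_nth)
qed simp

text \<open>
  A column of a ribbon meets consecutive rows, and all rows strictly between its lowest and highest box
  consist of a single box. Strictness along columns is therefore equivalent to strictness at the corners
  where a row passes into the next one.
\<close>

lemma semistandard_iff_filling:
  assumes comp: "composition \<beta>"
  shows "semistandard (ribbon_outer \<beta>) (ribbon_inner \<beta>) T \<longleftrightarrow>
    T \<in> extensional (skew_diagram (ribbon_outer \<beta>) (ribbon_inner \<beta>)) \<and>
    map (map T) (ribbon_cells \<beta>) \<in> ribbon_fillings \<beta>"
proof -
  define k where "k = length \<beta>"
  define a where "a = row_start \<beta>"
  define D where "D = skew_diagram (ribbon_outer \<beta>) (ribbon_inner \<beta>)"
  \<comment> \<open>\<open>U i\<close> holds the entries of row \<open>i\<close> counted from the bottom.\<close>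
  define U where "U = (\<lambda>i j. T (k - Suc i, j))"
  note aS = row_start_Suc[OF comp, folded a_def k_def]
  note amono = row_start_mono[OF comp, folded a_def k_def]
  have D: "(k - Suc i, j) \<in> D \<longleftrightarrow> a i \<le> j \<and> j \<le> a (Suc i)" if "i < k" for i j
    using ribbon_diagram_row[OF comp] that by (simp add: k_def a_def D_def)
  have rowsD: "\<exists>i<k. r = k - Suc i" if "(r, j) \<in> D" for r j
  proof -
    have "r < k"
      using that by (auto simp: D_def k_def skew_diagram_def part_def ribbon_outer_def split: if_splits)
    then show ?thesis by (intro exI[of _ "k - Suc r"]) auto
  qed
  have pos: "0 < \<beta> ! i" if "i < k" for i
    using that comp by (auto simp: composition_def k_def)
  have rows: "(\<forall>i j j'. (i, j) \<in> D \<longrightarrow> (i, j') \<in> D \<longrightarrow> j < j' \<longrightarrow> T (i, j) \<le> T (i, j')) \<longleftrightarrow>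
      (\<forall>b\<in>set (map (map T) (ribbon_cells \<beta>)). sorted b)" (is "?R \<longleftrightarrow> ?S")
  proof -
    have "?R \<longleftrightarrow> (\<forall>i<k. \<forall>j j'. a i \<le> j \<longrightarrow> j < j' \<longrightarrow> j' \<le> a (Suc i) \<longrightarrow> U i j \<le> U i j')"
    proof
      assume ?R
      show "\<forall>i<k. \<forall>j j'. a i \<le> j \<longrightarrow> j < j' \<longrightarrow> j' \<le> a (Suc i) \<longrightarrow> U i j \<le> U i j'"
      proof (intro allI impI)
        fix i j j' assume i: "i < k" and j: "a i \<le> j" "j < j'" "j' \<le> a (Suc i)"
        have "(k - Suc i, j) \<in> D" "(k - Suc i, j') \<in> D" unfolding D[OF i] using j by simp_all
        then show "U i j \<le> U i j'" unfolding U_def using \<open>?R\<close> j by blast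
      qed
    next
      assume U: "\<forall>i<k. \<forall>j j'. a i \<le> j \<longrightarrow> j < j' \<longrightarrow> j' \<le> a (Suc i) \<longrightarrow> U i j \<le> U i j'"
      show ?R
      proof (intro allI impI)
        fix r j j' assume *: "(r, j) \<in> D" "(r, j') \<in> D" "j < j'"
        obtain i where i: "i < k" "r = k - Suc i" using rowsD[OF *(1)] by blast
        have "a i \<le> j" "j' \<le> a (Suc i)" using * D[OF i(1)] unfolding i(2) by simp_all
        then show "T (r, j) \<le> T (r, j')" using U i *(3) unfolding U_def by blast
      qed
    qed
    also have "\<dots> \<longleftrightarrow> (\<forall>i<k. sorted (map (\<lambda>t. U i (a i + t)) [0..<\<beta> ! i]))"
    proof (intro all_cong1 imp_cong refl)
      fix i assume i: "i < k"
      show "(\<forall>j j'. a i \<le> j \<longrightarrow> j < j' \<longrightarrow> j' \<le> a (Suc i) \<longrightarrow> U i j \<le> U i j') \<longleftrightarrow>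
          sorted (map (\<lambda>t. U i (a i + t)) [0..<\<beta> ! i])" (is "?l \<longleftrightarrow> ?r")
      proof
        assume ?l
        then show ?r using aS[OF i] by (auto simp: sorted_wrt_iff_nth_less)
      next
        assume r: ?r
        show ?l
        proof (intro allI impI)
          fix j j' assume j: "a i \<le> j" "j < j'" "j' \<le> a (Suc i)"
          then have "j - a i < j' - a i" "j' - a i < \<beta> ! i" using aS[OF i] by linarith+
          then show "U i j \<le> U i j'" using r j by (force simp: sorted_wrt_iff_nth_less)
        qed
      qed
    qed
    also have "\<dots> \<longleftrightarrow> ?S" by (auto simp: ribbon_cells_def U_def a_def k_def o_def)
    finally show ?thesis .
  qed
  have cols: "(\<forall>i i' j. (i, j) \<in> D \<longrightarrow> (i', j) \<in> D \<longrightarrow> i < i' \<longrightarrow> T (i, j) < T (i', j)) \<longleftrightarrow>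
      successively (\<lambda>b c. hd c < last b) (map (map T) (ribbon_cells \<beta>))" (is "?C \<longleftrightarrow> ?S")
  proof -
    have "?S \<longleftrightarrow> (\<forall>i. Suc i < k \<longrightarrow> U (Suc i) (a (Suc i)) < U i (a (Suc i)))"
    proof -
      have "last (map T (ribbon_cells \<beta> ! i)) = U i (a (Suc i))" if "i < k" for i
      proof -
        have "a i + (\<beta> ! i - 1) = a (Suc i)" using aS[OF that] pos[OF that] by linarith
        then show ?thesis using pos[OF that] that
          by (simp add: ribbon_cells_def U_def last_map k_def a_def)
      qed
      moreover have "hd (map T (ribbon_cells \<beta> ! i)) = U i (a i)" if "i < k" for i
        using pos[OF that] that by (simp add: ribbon_cells_def U_def hd_map k_def a_def)
      moreover have "length (ribbon_cells \<beta>) = k" by (simp add: ribbon_cells_def k_def)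
      ultimately show ?thesis by (auto simp: successively_conv_nth)
    qed
    also have "\<dots> \<longleftrightarrow> ?C"
    proof
      assume ?C
      show "\<forall>i. Suc i < k \<longrightarrow> U (Suc i) (a (Suc i)) < U i (a (Suc i))"
      proof (intro allI impI)
        fix i assume i: "Suc i < k"
        have "(k - Suc (Suc i), a (Suc i)) \<in> D" "(k - Suc i, a (Suc i)) \<in> D"
          using i D amono[of i "Suc i"] amono[of "Suc i" "Suc (Suc i)"] by auto
        moreover have "k - Suc (Suc i) < k - Suc i" using i by simp
        ultimately show "U (Suc i) (a (Suc i)) < U i (a (Suc i))" using \<open>?C\<close> unfolding U_def by blast
      qed
    next
      assume corner: "\<forall>i. Suc i < k \<longrightarrow> U (Suc i) (a (Suc i)) < U i (a (Suc i))"
      have chain: "U i j < U i' j" if "i' < i" "i < k" "a i \<le> j" "j \<le> a (Suc i')" for i i' j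
        using that
      proof (induction i)
        case (Suc i)
        have mono: "a i \<le> a (Suc i)" "a (Suc i') \<le> a (Suc i)" using Suc.prems by (auto intro: amono)
        \<comment> \<open>A column that row \<open>Suc i\<close> shares with a lower row passes through the first box of row \<open>Suc i\<close>.\<close>
        then have j: "j = a (Suc i)" using Suc.prems by linarith
        have step: "U (Suc i) j < U i j" using corner Suc.prems j by simp
        show ?case
        proof (cases "i = i'")
          case False
          then have "U i j < U i' j" using Suc.prems mono by (intro Suc.IH) linarith+
          then show ?thesis using step by simp
        qed (use step in simp)
      qed simp
      show ?C
      proof (intro allI impI)
        fix r r' j assume *: "(r, j) \<in> D" "(r', j) \<in> D" "r < r'"
        then obtain i i' where i: "r = k - Suc i" "i < k" "r' = k - Suc i'" "i' < k"
          using rowsD by blast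
        then show "T (r, j) < T (r', j)"
          using chain[of i' i j] * D unfolding U_def by auto
      qed
    qed
    finally show ?thesis by blast
  qed
  have "map length (map (map T) (ribbon_cells \<beta>)) = \<beta>"
    using length_ribbon_cells[of \<beta>] by (simp add: o_def)
  then show ?thesis
    unfolding semistandard_def ribbon_fillings_def D_def[symmetric] rows cols by simp
qed

text \<open>
  A tableau is determined by its filling, and every filling with the right row lengths comes from some
  assignment of entries to the boxes.
\<close>

lemma ribbon_schur_conv_fillings:
  assumes comp: "composition \<beta>"
  shows "ribbon_schur \<beta> m = int (card {bs \<in> ribbon_fillings \<beta>. mset (concat bs) = m})"
proof -
  define D where "D = skew_diagram (ribbon_outer \<beta>) (ribbon_inner \<beta>)"
  define cs where "cs = ribbon_cells \<beta>"
  define \<phi> :: "(nat \<times> nat \<Rightarrow> nat) \<Rightarrow> nat list list" where "\<phi> = (\<lambda>T. map (map T) cs)"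
  let ?A = "{T. semistandard (ribbon_outer \<beta>) (ribbon_inner \<beta>) T \<and>
      content (ribbon_outer \<beta>) (ribbon_inner \<beta>) T = m}"
  let ?B = "{bs \<in> ribbon_fillings \<beta>. mset (concat bs) = m}"
  have setD: "set (concat cs) = D" and dist: "distinct (concat cs)"
    using set_ribbon_cells distinct_ribbon_cells comp by (simp_all add: D_def cs_def)
  have "content (ribbon_outer \<beta>) (ribbon_inner \<beta>) T = mset (concat (\<phi> T))" for T
    unfolding content_def D_def[symmetric] setD[symmetric] mset_set_set[OF dist]
    by (simp add: \<phi>_def flip: map_concat)
  then have A: "?A = {T \<in> extensional D. \<phi> T \<in> ?B}"
    using semistandard_iff_filling[OF comp] by (auto simp: \<phi>_def D_def cs_def)
  have "inj_on \<phi> (extensional D)"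
  proof (rule inj_onI)
    fix T T' assume T: "T \<in> extensional D" "T' \<in> extensional D" "\<phi> T = \<phi> T'"
    then have "map T (concat cs) = map T' (concat cs)" by (simp only: \<phi>_def map_concat)
    then show "T = T'" using T(1,2) setD by (intro extensionalityI[of _ D]) auto
  qed
  moreover have "\<exists>T \<in> extensional D. \<phi> T = bs" if bs: "bs \<in> ribbon_fillings \<beta>" for bs
  proof -
    have len: "map length bs = map length cs"
      using bs length_ribbon_cells by (simp add: ribbon_fillings_def cs_def)
    then have "length (concat cs) = length (concat bs)" by (simp add: length_concat)
    then obtain T where T: "T \<in> extensional D" "map T (concat cs) = concat bs"
      using ex_extensional_map[OF dist] setD by metis
    have "\<phi> T = bs"
    proof (rule concat_injective)
      show "concat (\<phi> T) = concat bs" using T by (simp add: \<phi>_def map_concat)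
      show len': "length (\<phi> T) = length bs" using map_eq_imp_length_eq[OF len] by (simp add: \<phi>_def)
      show "\<forall>(x, y)\<in>set (zip (\<phi> T) bs). length x = length y"
        using len len' by (auto simp: set_zip \<phi>_def list_eq_iff_nth_eq)
    qed
    then show ?thesis using T by blast
  qed
  ultimately have "bij_betw \<phi> ?A ?B"
    unfolding A bij_betw_def by (auto intro: inj_on_subset)
  then show ?thesis
    unfolding ribbon_schur_def skew_schur_def by (simp add: bij_betw_same_card)
qed

section \<open>Coefficients and evaluations\<close>

lemma prod_list_map_mset: "prod_list (map x w) = prod_mset (image_mset x (mset w))"
  by (induction w) simp_all

definition filling_content :: "nat list list \<Rightarrow> nat multiset" where
  "filling_content bs = mset (concat bs)"

lemma bounded_fillings_iff_content:
  "bs \<in> bounded_fillings N \<beta> \<longleftrightarrow> bs \<in> ribbon_fillings \<beta> \<and> set_mset (filling_content bs) \<subseteq> {..<N}"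
  by (simp only: bounded_fillings_def mem_Collect_eq filling_content_def set_mset_mset)

text \<open>
  The bound on the entries of a filling depends only on its content, so bounding the entries keeps some
  coefficients unchanged and deletes all others.
\<close>

lemma card_bounded_fillings_content:
  assumes "composition \<beta>"
  shows "int (card {bs \<in> bounded_fillings N \<beta>. filling_content bs = m}) =
    (if set_mset m \<subseteq> {..<N} then ribbon_schur \<beta> m else 0)"
proof -
  have "{bs \<in> bounded_fillings N \<beta>. filling_content bs = m} =
      (if set_mset m \<subseteq> {..<N} then {bs \<in> ribbon_fillings \<beta>. filling_content bs = m} else {})"
    by (auto simp: bounded_fillings_iff_content)
  then show ?thesis
    by (simp add: ribbon_schur_conv_fillings[OF assms] flip: filling_content_def)
qed

text \<open>
  The evaluation groups fillings by content, and the size of each group is a coefficient.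
\<close>

lemma ribbon_sum_cong:
  assumes "composition \<beta>" "composition \<gamma>" "ribbon_schur \<beta> = ribbon_schur \<gamma>"
  shows "ribbon_sum N x \<beta> = ribbon_sum N x \<gamma>"
proof -
  have sum: "ribbon_sum N x \<delta> = (\<Sum>m\<in>#image_mset filling_content (mset_set (bounded_fillings N \<delta>)).
      prod_mset (image_mset x m))" for \<delta>
    unfolding ribbon_sum_def prod_list_map_mset filling_content_def[symmetric]
    by (simp only: sum_unfold_sum_mset image_mset.compositionality o_def)
  have "count (image_mset filling_content (mset_set (bounded_fillings N \<delta>))) m =
      card {bs \<in> bounded_fillings N \<delta>. filling_content bs = m}" for \<delta> m
    by (simp add: count_image_mset' finite_bounded_fillings eq_commute)
  moreover have "card {bs \<in> bounded_fillings N \<beta>. filling_content bs = m} =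
      card {bs \<in> bounded_fillings N \<gamma>. filling_content bs = m}" for m
    using card_bounded_fillings_content[OF assms(1), of N m]
      card_bounded_fillings_content[OF assms(2), of N m] assms(3)
    by (simp only: of_nat_eq_iff[symmetric, where 'a = int])
  ultimately have "image_mset filling_content (mset_set (bounded_fillings N \<beta>)) =
      image_mset filling_content (mset_set (bounded_fillings N \<gamma>))"
    by (intro multiset_eqI) simp
  then show ?thesis unfolding sum by simp
qed

text \<open>
  The functions from monomials to integers with finite support form the polynomial ring in the variables
  \<open>x\<^sub>0, x\<^sub>1, \<dots>\<close>, with convolution as the product.
\<close>

definition formal_variable :: "nat \<Rightarrow> nat multiset \<Rightarrow>\<^sub>0 int" where
  "formal_variable i = Poly_Mapping.single {#i#} 1"

text \<open>
  At formal variables each filling evaluates to the monomial of its content, so that the coefficients can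
  be read off from the evaluation.
\<close>

lemma lookup_ribbon_sum:
  assumes "composition \<beta>" "set_mset m \<subseteq> {..<N}"
  shows "Poly_Mapping.lookup (ribbon_sum N formal_variable \<beta>) m = ribbon_schur \<beta> m"
proof -
  have "prod_list (map formal_variable w) = Poly_Mapping.single (mset w) 1" for w
    by (induction w) (simp_all add: formal_variable_def mult_single)
  then have "Poly_Mapping.lookup (ribbon_sum N formal_variable \<beta>) m =
      (\<Sum>bs\<in>bounded_fillings N \<beta>. if filling_content bs = m then 1 else 0)"
    unfolding ribbon_sum_def lookup_sum filling_content_def
    by (simp only: lookup_single when_def)
  also have "\<dots> = int (card {bs \<in> bounded_fillings N \<beta>. filling_content bs = m})"
    by (simp add: finite_bounded_fillings flip: sum.inter_filter)
  finally show ?thesis using card_bounded_fillings_content assms by simp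
qed

section \<open>Expansion over sorted coarsenings\<close>

lemma mset_sorted_partition: "mset (sorted_partition \<alpha>) = mset \<alpha>"
  by (simp add: sorted_partition_def)

lemma length_sorted_partition: "length (sorted_partition \<alpha>) = length \<alpha>"
  by (simp add: sorted_partition_def)

lemma coarsening_partitionsE:
  assumes "composition \<beta>" "lam \<in># coarsening_partitions \<beta>"
  obtains \<alpha> where "coarsening \<alpha> \<beta>" "lam = sorted_partition \<alpha>"
  using assms by (auto simp: coarsening_partitions_def finite_coarsenings)

lemma sorted_partition_in_coarsening_partitions:
  "composition \<beta> \<Longrightarrow> sorted_partition \<beta> \<in># coarsening_partitions \<beta>"
  by (auto simp: coarsening_partitions_def finite_coarsenings coarsening_refl)

text \<open>
  Products in a commutative ring do not see the order of the parts.
\<close>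

lemma ribbon_sum_coarsening_partitions:
  assumes "composition \<beta>"
  shows "ribbon_sum N x \<beta> = (\<Sum>lam\<in>#coarsening_partitions \<beta>.
    (-1) ^ (length \<beta> + length lam) * prod_list (map (complete_sum N x) lam))"
proof -
  have "prod_list (map (complete_sum N x) (sorted_partition \<alpha>)) =
      prod_list (map (complete_sum N x) \<alpha>)" for \<alpha>
    by (simp only: prod_list_map_mset mset_sorted_partition)
  then show ?thesis
    by (simp add: ribbon_sum_expansion[OF assms] coarsening_partitions_def sum_unfold_sum_mset
        image_mset.compositionality o_def length_sorted_partition)
qed

text \<open>
  Sorting preserves length, and no coarsening of \<open>\<gamma>\<close> is longer than \<open>\<gamma>\<close>.
\<close>

lemma length_le_if_coarsening_partitions_eq:
  assumes "composition \<beta>" "composition \<gamma>" "coarsening_partitions \<beta> = coarsening_partitions \<gamma>"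
  shows "length \<beta> \<le> length \<gamma>"
proof -
  have "sorted_partition \<beta> \<in># coarsening_partitions \<gamma>"
    using sorted_partition_in_coarsening_partitions[OF assms(1)] assms(3) by simp
  then obtain \<alpha> where "coarsening \<alpha> \<gamma>" "sorted_partition \<beta> = sorted_partition \<alpha>"
    using coarsening_partitionsE[OF assms(2)] by blast
  then show ?thesis by (metis coarsening_length length_sorted_partition)
qed

section \<open>Values of the complete homogeneous polynomials\<close>

lemma complete_sum_0: "complete_sum N x 0 = 1"
proof -
  have "sorted_words N 0 = {[]}" by (auto simp: sorted_words_def)
  then show ?thesis by (simp add: complete_sum_def)
qed

lemma complete_sum_no_variables: "complete_sum 0 x (Suc k) = 0"
proof -
  have "sorted_words 0 (Suc k) = {}" by (auto simp: sorted_words_def)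
  then show ?thesis by (simp add: complete_sum_def)
qed

text \<open>
  A weakly increasing word either avoids the largest admissible entry or ends with it.
\<close>

lemma complete_sum_Suc_Suc:
  "complete_sum (Suc N) x (Suc k) = complete_sum N x (Suc k) + x N * complete_sum (Suc N) x k"
proof -
  have split: "sorted_words (Suc N) (Suc k) =
      sorted_words N (Suc k) \<union> (\<lambda>w. w @ [N]) ` sorted_words (Suc N) k" (is "?L = ?A \<union> ?B")
  proof
    show "?A \<union> ?B \<subseteq> ?L"
      by (auto simp: sorted_words_def sorted_append less_Suc_eq_le subset_iff less_Suc_eq)
    show "?L \<subseteq> ?A \<union> ?B"
    proof
      fix w assume w: "w \<in> ?L"
      then obtain v c where v: "w = v @ [c]" by (cases w rule: rev_cases) (auto simp: sorted_words_def)
      show "w \<in> ?A \<union> ?B"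
      proof (cases "c = N")
        case True
        then show ?thesis using w v by (auto simp: sorted_words_def sorted_append)
      next
        case False
        then have "c < N" using w v by (auto simp: sorted_words_def)
        then show ?thesis using w v by (auto simp: sorted_words_def sorted_append)
      qed
    qed
  qed
  have "?A \<inter> ?B = {}" by (auto simp: sorted_words_def)
  then show ?thesis
    unfolding complete_sum_def split
    by (simp add: sum.union_disjoint finite_sorted_words sum.reindex inj_on_def
        sum_distrib_left mult.commute)
qed

text \<open>
  The generating function \<open>\<Sum> h\<^sub>k t\<^sup>k = \<Prod> 1 / (1 - x\<^sub>i t)\<close>, stated without division so that it makes sense
  over every commutative ring.
\<close>

lemma complete_sum_generating_function:
  includes fps_syntax
  fixes x :: "nat \<Rightarrow> 'a::comm_ring_1"
  shows "(\<Prod>i<N. 1 - fps_const (x i) * fps_X) * Abs_fps (complete_sum N x) = 1"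
proof (induction N)
  case 0
  have "Abs_fps (complete_sum 0 x) = 1"
  proof (rule fps_ext)
    fix k show "Abs_fps (complete_sum 0 x) $ k = 1 $ k"
      by (cases k) (simp_all add: complete_sum_0 complete_sum_no_variables)
  qed
  then show ?case by simp
next
  case (Suc N)
  have "(1 - fps_const (x N) * fps_X) * Abs_fps (complete_sum (Suc N) x) =
      Abs_fps (complete_sum N x)"
  proof (rule fps_ext)
    fix k show "((1 - fps_const (x N) * fps_X) * Abs_fps (complete_sum (Suc N) x)) $ k =
        Abs_fps (complete_sum N x) $ k"
      by (cases k) (simp_all add: algebra_simps complete_sum_0 complete_sum_Suc_Suc mult.assoc)
  qed
  then show ?case using Suc by (simp add: mult.assoc)
qed

text \<open>
  Let \<open>Y\<close> be the power series with constant term \<open>1\<close> and the prescribed coefficients. Truncating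
  \<open>1 / Y\<close> after degree \<open>n\<close> gives a polynomial with constant term \<open>1\<close>, which over the complex numbers splits
  into factors \<open>1 - x\<^sub>i t\<close>. The generating function of the \<open>h\<^sub>k\<close> at these \<open>x\<^sub>i\<close> is the inverse of that
  polynomial, and it agrees with \<open>Y\<close> up to degree \<open>n\<close>.
\<close>

lemma complete_sums_arbitrary:
  includes fps_syntax
  fixes y :: "nat \<Rightarrow> complex"
  shows "\<exists>N x. \<forall>k. 0 < k \<longrightarrow> k \<le> n \<longrightarrow> complete_sum N x k = y k"
proof -
  define Y where "Y = Abs_fps (\<lambda>k. if k = 0 then 1 else y k)"
  define E where "E = truncate_fps (Suc n) (inverse Y)"
  have Y0: "Y $ 0 = 1" by (simp add: Y_def)
  have E0: "coeff E 0 = 1" by (simp add: E_def Y0 coeff_truncate_fps)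
  obtain r where r: "smult (lead_coeff E) (\<Prod>i<degree E. [:- r i, 1:]) = E"
    using complex_poly_decompose'[of E] by blast
  define N where "N = degree E"
  define x where "x = (\<lambda>i. inverse (r i))"
  have prod0: "lead_coeff E * (\<Prod>i<N. - r i) = 1"
  proof -
    have "poly (smult (lead_coeff E) (\<Prod>i<degree E. [:- r i, 1:])) 0 = 1"
      unfolding r using E0 by (simp add: poly_0_coeff_0)
    then show ?thesis by (simp add: poly_prod N_def)
  qed
  \<comment> \<open>Zero is not a root, since the constant term is \<open>1\<close>.\<close>
  have nz: "r i \<noteq> 0" if "i < N" for i
  proof
    assume "r i = 0"
    then have "\<exists>i\<in>{..<N}. - r i = 0" using that by auto
    then have "(\<Prod>i<N. - r i) = 0" by (rule prod_zero[rotated]) simp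
    then have "lead_coeff E * (\<Prod>i<N. - r i) = 0" by (simp only: mult_zero_right)
    then show False unfolding prod0 by simp
  qed
  have "E = smult (lead_coeff E) (\<Prod>i<N. smult (- r i) [:1, - x i:])"
  proof -
    have "(\<Prod>i<N. smult (- r i) [:1, - x i:]) = (\<Prod>i<N. [:- r i, 1:])"
      using nz by (intro prod.cong) (auto simp: x_def)
    then show ?thesis using r by (simp add: N_def)
  qed
  also have "\<dots> = (\<Prod>i<N. [:1, - x i:])"
    by (simp only: prod_smult smult_smult prod0 smult_1_left)
  finally have "fps_of_poly E = (\<Prod>i<N. 1 - fps_const (x i) * fps_X)"
    by (simp only: fps_of_poly_prod fps_of_poly_linear' fps_const_neg[symmetric])
      (simp only: diff_conv_add_uminus mult_minus_left)
  then have EH: "fps_of_poly E * Abs_fps (complete_sum N x) = 1"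
    using complete_sum_generating_function[of x N] by simp
  have "complete_sum N x k = Y $ k" if k: "k \<le> n" for k
  proof -
    have low: "(inverse Y * Abs_fps (complete_sum N x)) $ l = 1 $ l" if "l \<le> n" for l
    proof -
      have "(inverse Y * Abs_fps (complete_sum N x)) $ l =
          (fps_of_poly E * Abs_fps (complete_sum N x)) $ l"
        unfolding fps_mult_nth using that
        by (intro sum.cong) (auto simp: E_def coeff_truncate_fps)
      then show ?thesis by (simp add: EH)
    qed
    have "Abs_fps (complete_sum N x) = Y * (inverse Y * Abs_fps (complete_sum N x))"
      using Y0 by (simp add: inverse_mult_eq_1' flip: mult.assoc)
    then have "complete_sum N x k = (Y * (inverse Y * Abs_fps (complete_sum N x))) $ k"
      by (metis fps_nth_Abs_fps)
    also have "\<dots> = (Y * 1) $ k"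
      unfolding fps_mult_nth[of Y] using k
      by (intro sum.cong refl arg_cong2[where f = "(*)"] low) simp
    finally show ?thesis by simp
  qed
  then show ?thesis by (intro exI[of _ N] exI[of _ x]) (auto simp: Y_def)
qed

section \<open>Separating partitions by exponents\<close>

definition base_code :: "nat \<Rightarrow> nat list \<Rightarrow> nat" where
  "base_code B lam = (\<Sum>k\<leftarrow>lam. B ^ k)"

text \<open>
  This is uniqueness of the base \<open>B\<close> expansion: the digit at position \<open>k\<close> is the number of parts equal
  to \<open>k\<close>, and it is less than \<open>B\<close>.
\<close>

lemma base_code_inj:
  assumes "sorted_wrt (\<ge>) lam" "sorted_wrt (\<ge>) mu" "length lam < B" "length mu < B"
    "base_code B lam = base_code B mu"
  shows "lam = mu"
  using assms
proof (induction lam arbitrary: mu)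
  case Nil
  then have "B \<noteq> 0" "base_code B mu = 0" by (simp_all add: base_code_def)
  then show ?case by (cases mu) (simp_all add: base_code_def)
next
  case (Cons p lam)
  have B: "1 < B" using Cons.prems(3) by simp
  then have "0 < base_code B (p # lam)" by (simp add: base_code_def)
  then have "mu \<noteq> []" using Cons.prems(5) by (intro notI) (simp add: base_code_def[of _ "[]"])
  then obtain q nu where mu: "mu = q # nu" by (cases mu) simp_all
  \<comment> \<open>Fewer than \<open>B\<close> parts produce no carry, so the largest part is the leading digit.\<close>
  have bounds: "B ^ r \<le> base_code B (r # xs)" "base_code B (r # xs) < B ^ Suc r"
    if "sorted_wrt (\<ge>) (r # xs)" "length (r # xs) < B" for r xs
  proof -
    have "base_code B ys \<le> length ys * B ^ r" if "\<forall>k\<in>set ys. k \<le> r" for ys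
      using that B by (induction ys) (auto simp: base_code_def intro!: add_mono power_increasing)
    from this[of "r # xs"] have "base_code B (r # xs) \<le> length (r # xs) * B ^ r"
      using that(1) by simp
    also have "\<dots> < B * B ^ r" using that by (intro mult_strict_right_mono) auto
    finally show "base_code B (r # xs) < B ^ Suc r" by simp
  qed (simp add: base_code_def)
  have "B ^ p < B ^ Suc q" "B ^ q < B ^ Suc p"
    using bounds[of p lam] bounds[of q nu] Cons.prems unfolding mu by (metis order.strict_trans1)+
  then have "p = q" unfolding power_strict_increasing_iff[OF B] by simp
  then show ?case using Cons.IH[of nu] Cons.prems mu by (simp add: base_code_def)
qed

text \<open>
  The expansion of \<open>r\<^sub>\<beta>\<close> under the substitution \<open>h\<^sub>k = z\<^bsup>B\<^sup>k\<^esup>\<close>, as a polynomial in \<open>z\<close>.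
\<close>

definition coarsening_polynomial :: "nat \<Rightarrow> nat list \<Rightarrow> complex poly" where
  "coarsening_polynomial B \<beta> = (\<Sum>lam\<in>#coarsening_partitions \<beta>.
     monom ((-1) ^ (length \<beta> + length lam)) (base_code B lam))"

text \<open>
  By injectivity of the codes no other partition contributes to this coefficient.
\<close>

lemma coeff_coarsening_polynomial:
  assumes "composition \<beta>" "length \<beta> < B" "sorted_wrt (\<ge>) lam" "length lam < B"
  shows "coeff (coarsening_polynomial B \<beta>) (base_code B lam) =
    (-1) ^ (length \<beta> + length lam) * of_nat (count (coarsening_partitions \<beta>) lam)"
proof -
  have coeff_sum: "coeff (\<Sum>mu\<in>#M. monom (s mu) (base_code B mu)) (base_code B lam) =
      s lam * of_nat (count M lam)"
    if "\<And>mu. mu \<in># M \<Longrightarrow> base_code B mu = base_code B lam \<Longrightarrow> mu = lam"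
    for M and s :: "nat list \<Rightarrow> complex"
    using that by (induction M) (auto simp: algebra_simps)
  have "mu = lam"
    if mu: "mu \<in># coarsening_partitions \<beta>" "base_code B mu = base_code B lam" for mu
  proof -
    obtain \<alpha> where \<alpha>: "coarsening \<alpha> \<beta>" "mu = sorted_partition \<alpha>"
      using coarsening_partitionsE[OF assms(1) mu(1)] by blast
    then have "sorted_wrt (\<ge>) mu" "length mu < B"
      using coarsening_length[OF \<alpha>(1)] assms(2)
      by (simp_all add: sorted_partition_def sorted_wrt_rev)
    then show ?thesis using base_code_inj[OF _ assms(3) _ assms(4) mu(2)] by simp
  qed
  then show ?thesis unfolding coarsening_polynomial_def by (rule coeff_sum)
qed

lemma poly_coarsening_polynomial:
  assumes "composition \<beta>" "\<And>k. 0 < k \<Longrightarrow> k \<le> sum_list \<beta> \<Longrightarrow> complete_sum N x k = z ^ (B ^ k)"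
  shows "poly (coarsening_polynomial B \<beta>) z = ribbon_sum N x \<beta>"
proof -
  have "prod_list (map (complete_sum N x) lam) = z ^ base_code B lam"
    if lam: "lam \<in># coarsening_partitions \<beta>" for lam
  proof -
    obtain \<alpha> where \<alpha>: "coarsening \<alpha> \<beta>" "lam = sorted_partition \<alpha>"
      using coarsening_partitionsE[OF assms(1) lam] by blast
    have "set lam = set \<alpha>" by (simp add: \<alpha>(2) sorted_partition_def)
    then have "\<forall>k\<in>set lam. 0 < k \<and> k \<le> sum_list \<beta>"
      using coarsening_composition[OF \<alpha>(1) assms(1)] coarsening_sum_list[OF \<alpha>(1)]
      using member_le_sum_list[of _ \<alpha>] by (auto simp: composition_def)
    then have "map (complete_sum N x) lam = map (\<lambda>k. z ^ (B ^ k)) lam"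
      using assms(2) by auto
    moreover have "prod_list (map (\<lambda>k. z ^ (B ^ k)) lam) = z ^ base_code B lam"
      by (induction lam) (simp_all add: base_code_def power_add)
    ultimately show ?thesis by (simp only:)
  qed
  then have "ribbon_sum N x \<beta> = (\<Sum>lam\<in>#coarsening_partitions \<beta>.
      (-1) ^ (length \<beta> + length lam) * z ^ base_code B lam)"
    unfolding ribbon_sum_coarsening_partitions[OF assms(1)]
    by (intro arg_cong[where f = sum_mset] image_mset_cong) simp
  moreover have "poly (\<Sum>lam\<in>#M. monom (s lam) (e lam)) z = (\<Sum>lam\<in>#M. s lam * z ^ e lam)"
    for M :: "nat list multiset" and s e
    by (induction M) (simp_all add: poly_monom)
  ultimately show ?thesis by (simp add: coarsening_polynomial_def)
qed

section \<open>Equality of ribbon Schur functions\<close>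

theorem theorem2p6:
  fixes \<beta> \<gamma> :: "nat list"
  assumes "composition \<beta>" and "composition \<gamma>"
  shows "ribbon_schur \<beta> = ribbon_schur \<gamma> \<longleftrightarrow>
    coarsening_partitions \<beta> = coarsening_partitions \<gamma>"
proof
  assume eq: "coarsening_partitions \<beta> = coarsening_partitions \<gamma>"
  then have "length \<beta> = length \<gamma>"
    using length_le_if_coarsening_partitions_eq assms by (metis le_antisym)
  then have sums: "ribbon_sum N formal_variable \<beta> = ribbon_sum N formal_variable \<gamma>" for N
    using assms eq by (simp add: ribbon_sum_coarsening_partitions)
  show "ribbon_schur \<beta> = ribbon_schur \<gamma>"
  proof
    fix m :: "nat multiset"
    obtain N where "set_mset m \<subseteq> {..<N}"
      using finite_nat_iff_bounded[of "set_mset m"] by auto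
    then show "ribbon_schur \<beta> m = ribbon_schur \<gamma> m"
      using lookup_ribbon_sum[OF assms(1)] lookup_ribbon_sum[OF assms(2)] sums by metis
  qed
next
  assume eq: "ribbon_schur \<beta> = ribbon_schur \<gamma>"
  \<comment> \<open>Larger than the number of parts of every coarsening of \<open>\<beta>\<close> or \<open>\<gamma>\<close>.\<close>
  define B where "B = Suc (length \<beta> + length \<gamma>)"
  have "poly (coarsening_polynomial B \<beta>) z = poly (coarsening_polynomial B \<gamma>) z" for z
  proof -
    obtain N x where
      x: "\<And>k. 0 < k \<Longrightarrow> k \<le> sum_list \<beta> + sum_list \<gamma> \<Longrightarrow> complete_sum N x k = z ^ (B ^ k)"
      using complete_sums_arbitrary[of "sum_list \<beta> + sum_list \<gamma>" "\<lambda>k. z ^ (B ^ k)"] by blast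
    show ?thesis
      using ribbon_sum_cong[OF assms eq, of N x] poly_coarsening_polynomial[of _ N x z B] assms x
      by simp
  qed
  then have "poly (coarsening_polynomial B \<beta>) = poly (coarsening_polynomial B \<gamma>)"
    by (rule ext)
  then have polys: "coarsening_polynomial B \<beta> = coarsening_polynomial B \<gamma>"
    by (simp only: poly_eq_poly_eq_iff)
  have signed: "(-1) ^ length \<beta> * int (count (coarsening_partitions \<beta>) lam) =
      (-1) ^ length \<gamma> * int (count (coarsening_partitions \<gamma>) lam)" for lam
  proof (cases "lam \<in># coarsening_partitions \<beta> \<or> lam \<in># coarsening_partitions \<gamma>")
    case True
    then obtain \<alpha> where "lam = sorted_partition \<alpha>" "coarsening \<alpha> \<beta> \<or> coarsening \<alpha> \<gamma>"
      using coarsening_partitionsE assms by metis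
    then have "sorted_wrt (\<ge>) lam" "length lam < B"
      using coarsening_length[of \<alpha> \<beta>] coarsening_length[of \<alpha> \<gamma>]
      by (auto simp: sorted_partition_def sorted_wrt_rev B_def)
    then have "(-1) ^ (length \<beta> + length lam) * complex_of_nat (count (coarsening_partitions \<beta>) lam) =
        (-1) ^ (length \<gamma> + length lam) * of_nat (count (coarsening_partitions \<gamma>) lam)"
      using coeff_coarsening_polynomial[OF assms(1), of B lam]
        coeff_coarsening_polynomial[OF assms(2), of B lam] polys by (simp add: B_def)
    then have "complex_of_int ((-1) ^ length \<beta> * int (count (coarsening_partitions \<beta>) lam)) =
        complex_of_int ((-1) ^ length \<gamma> * int (count (coarsening_partitions \<gamma>) lam))"
      by (simp add: power_add)
    then show ?thesis by (simp only: of_int_eq_iff)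
  qed (simp add: not_in_iff)
  have pos: "0 < count (coarsening_partitions \<beta>) (sorted_partition \<beta>)"
    using sorted_partition_in_coarsening_partitions[OF assms(1)] by simp
  \<comment> \<open>Opposite signs would equate a positive with a nonpositive number at the partition of \<open>\<beta>\<close> itself.\<close>
  have "(-1::int) ^ length \<beta> = (-1) ^ length \<gamma>"
    using signed[of "sorted_partition \<beta>"] pos
    by (cases "even (length \<beta>)"; cases "even (length \<gamma>)") auto
  then show "coarsening_partitions \<beta> = coarsening_partitions \<gamma>"
    using signed by (intro multiset_eqI) simp
qed

end
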